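(* The set of forbidden numbers $q$ is dense in the interval $(0,4)$; that is, every nonempty open subinterval of $(0,4)$ contains a forbidden $q$.
   Context: For real $q>0$ and an integer sequence $\mathbf{m}=(m_0,\dots,m_k)\in\mathbf{Z}^{k+1}$ ($k\ge 0$) write $\mathbf{m}_j=(m_0,\dots,m_j)$ for $0\le j\le k$. Define $c(q,\mathbf{m})$ recursively by $c(q,(m_0))=m_0$ and $c(q,(m_0,\dots,m_k))=m_k+\frac{1}{q\,c(q,(m_0,\dots,m_{k-1}))}$ for $k\ge1$; equivalently $c(q,\mathbf{m})=m_k+\cfrac{1}{qm_{k-1}+\cfrac{q}{qm_{k-2}+\cfrac{q}{\ddots+\cfrac{q}{qm_0}}}}$. The sequence $\mathbf{m}$ is called a path (for $q$) if this expression is well defined, i.e. $c(q,\mathbf{m}_j)\neq0$ for all $0\le j\le k-1$. A path $\mathbf{m}$ is called a loop if $c(q,\mathbf{m})=0$; the set of loops for $q$ is denoted $L(q)$. The weight of a path is $w(q,\mathbf{m})=q^{k/2}\prod_{j=0}^{k-1}|c(q,\mathbf{m}_j)|$ (so $(0)\in L(q)$ has weight $1$). A number $q>0$ is called forbidden if there exists a loop $\mathbf{m}\in L(q)$ with $w(q,\mathbf{m})\neq1$. *)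

theory Defs
  imports Complex_Main
begin

text \<open>A sequence \<open>(m\<^sub>0, \<dots>, m\<^sub>k)\<close> is a nonempty list of length \<open>k + 1\<close>, and \<open>(m\<^sub>0, \<dots>, m\<^sub>j)\<close> is its
  prefix \<open>take (Suc j) ms\<close>. The value on the empty list is junk.\<close>

function cfrac :: "real \<Rightarrow> int list \<Rightarrow> real" where
  "cfrac q [] = 0"
| "cfrac q [m] = of_int m"
| "ms \<noteq> [] \<Longrightarrow> cfrac q (ms @ [m]) = of_int m + 1 / (q * cfrac q ms)"
proof -
  fix P :: bool and x :: "real \<times> int list"
  assume empty: "\<And>q. x = (q, []) \<Longrightarrow> P"
    and single: "\<And>q m. x = (q, [m]) \<Longrightarrow> P"
    and append: "\<And>ms q m. ms \<noteq> [] \<Longrightarrow> x = (q, ms @ [m]) \<Longrightarrow> P"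
  obtain q xs where x: "x = (q, xs)"
    by (cases x)
  show P
  proof (cases xs rule: rev_cases)
    case Nil
    then show P using empty x by simp
  next
    case (snoc ys y)
    then show P using single append x
      by (cases "ys = []") auto
  qed
qed auto
termination by (relation "measure (\<lambda>(q, ms). length ms)") auto

definition is_path :: "real \<Rightarrow> int list \<Rightarrow> bool" where
  "is_path q ms \<longleftrightarrow> ms \<noteq> [] \<and> (\<forall>j < length ms - 1. cfrac q (take (Suc j) ms) \<noteq> 0)"

definition loops :: "real \<Rightarrow> int list set" where
  "loops q = {ms. is_path q ms \<and> cfrac q ms = 0}"

definition weight :: "real \<Rightarrow> int list \<Rightarrow> real" where
  "weight q ms = q powr (real (length ms - 1) / 2) *
     (\<Prod>j < length ms - 1. \<bar>cfrac q (take (Suc j) ms)\<bar>)"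

definition forbidden :: "real \<Rightarrow> bool" where
  "forbidden q \<longleftrightarrow> q > 0 \<and> (\<exists>ms \<in> loops q. weight q ms \<noteq> 1)"

lemma zero_loop: "[0] \<in> loops q"
  by (simp add: loops_def is_path_def)

lemma weight_zero_loop: "q > 0 \<Longrightarrow> weight q [0] = 1"
  by (simp add: weight_def)

end

theory Submission
  imports Defs
begin

text \<open>Put \<open>q = 4 cos\<^sup>2 \<theta>\<close> and clear denominators by \<open>c(q, m\<^sub>j) = K (j + 1) / (sqrt q * K j)\<close>, where
  \<open>K\<close> satisfies a linear recurrence with \<open>K 0 = 1\<close>. A loop is a zero \<open>K (k + 1) = 0\<close>, and its weight
  telescopes to \<open>\<bar>K k\<bar>\<close>. For the coefficients \<open>1, \<dots>, 1, 2, 1, \<dots>, 1\<close> (up to alternating signs) with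
  \<open>A - 1\<close> ones before and \<open>2 A - 1\<close> ones after the \<open>2\<close>, the zero condition is
  \<open>sin (3 A \<theta>) sin \<theta> + 2 cos \<theta> sin (A \<theta>) sin (2 A \<theta>) = 0\<close>, and the weight is then
  \<open>\<bar>sin (A \<theta>) / sin (2 A \<theta>)\<bar>\<close>. Modulo \<open>\<pi>\<close>, a solution exists with \<open>\<pi>/3 < A \<theta> < \<pi>/2\<close>, where the weight
  \<open>1 / (2 cos (A \<theta>))\<close> exceeds \<open>1\<close>; letting \<open>A\<close> grow puts such a \<open>\<theta>\<close> into any given interval.\<close>

section \<open>Linearised continued fractions, loops and weights\<close>

lemma cfrac_eq_quotient:
  fixes m :: "nat \<Rightarrow> int" and K :: "nat \<Rightarrow> real"
  assumes "q > 0" and K0: "K 0 = 1" and K1: "K 1 = sqrt q * m 0"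
    and rec: "\<And>n. K (n + 2) = sqrt q * m (n + 1) * K (n + 1) + K n"
    and nz: "\<And>i. i < j \<Longrightarrow> K (i + 1) \<noteq> 0"
  shows "cfrac q (map m [0..<Suc j]) = K (j + 1) / (sqrt q * K j)"
  using nz
proof (induction j)
  case 0
  then show ?case using K0 K1 \<open>q > 0\<close> by simp
next
  case (Suc j)
  have IH: "cfrac q (map m [0..<Suc j]) = K (j + 1) / (sqrt q * K j)"
    using Suc by simp
  have nz1: "K (Suc j) \<noteq> 0" using Suc.prems[of j] by simp
  have "cfrac q (map m [0..<Suc (Suc j)]) = cfrac q (map m [0..<Suc j] @ [m (Suc j)])"
    by simp
  also have "\<dots> = m (Suc j) + 1 / (q * cfrac q (map m [0..<Suc j]))"
    by (rule cfrac.simps(3)) simp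
  \<comment> \<open>One factor \<open>sqrt q\<close> cancels against the denominator from
    \<open>IH\<close>; the other stays in the new quotient.\<close>
  also have "\<dots> = m (Suc j) + 1 / (sqrt q * sqrt q * (K (j + 1) / (sqrt q * K j)))"
    using IH \<open>q > 0\<close> by simp
  also have "\<dots> = m (Suc j) + K j / (sqrt q * K (Suc j))"
    using \<open>q > 0\<close> nz1 by (simp del: real_sqrt_mult_self)
  also have "\<dots> = (sqrt q * m (Suc j) * K (Suc j) + K j) / (sqrt q * K (Suc j))"
    using \<open>q > 0\<close> nz1 by (simp add: field_simps)
  also have "\<dots> = K (Suc j + 1) / (sqrt q * K (Suc j))"
    using rec[of j] by simp
  finally show ?case .
qed

text \<open>With \<open>r = sqrt q\<close> the left side is the weight: the powers of
  \<open>r\<close> cancel and the quotients telescope down to \<open>K 0 = 1\<close>.\<close>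

lemma prod_telescope_abs:
  fixes K :: "nat \<Rightarrow> real"
  assumes "K 0 = 1" and "\<And>i. i < n \<Longrightarrow> K (i + 1) \<noteq> 0" and "r > 0"
  shows "r ^ n * (\<Prod>j<n. \<bar>K (j + 1) / (r * K j)\<bar>) = \<bar>K n\<bar>"
  using assms(2)
proof (induction n)
  case 0
  then show ?case using assms by simp
next
  case (Suc n)
  have nz: "K n \<noteq> 0"
    using Suc.prems[of "n - 1"] \<open>K 0 = 1\<close> by (cases n) auto
  have "r ^ Suc n * (\<Prod>j<Suc n. \<bar>K (j + 1) / (r * K j)\<bar>) = \<bar>K n\<bar> * (r * \<bar>K (n + 1) / (r * K n)\<bar>)"
    using Suc by (simp add: mult_ac flip: Suc.IH)
  also have "\<dots> = \<bar>K (Suc n)\<bar>"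
    using nz \<open>r > 0\<close> by (simp add: abs_mult)
  finally show ?case .
qed

text \<open>The coefficients need not form a path: a proper prefix with \<open>K (j + 1) = 0\<close> is a shorter loop,
  hence of weight 1, and the recurrence restarts after it from \<open>K (j + 2) = K j = \<plusminus>1\<close>.\<close>

lemma abs_eq_1_if_not_forbidden:
  fixes m :: "nat \<Rightarrow> int" and K :: "nat \<Rightarrow> real"
  assumes "q > 0" and "\<not> forbidden q"
    and "K 0 = 1" and "K 1 = sqrt q * m 0"
    and "\<And>n. K (n + 2) = sqrt q * m (n + 1) * K (n + 1) + K n"
    and "K (n + 1) = 0"
  shows "\<bar>K n\<bar> = 1"
  using assms(3-)
proof (induction n arbitrary: m K rule: less_induct)
  case (less n m K)
  note rec = less.prems(3)
  show ?case
  proof (cases "\<exists>j<n. K (j + 1) = 0")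
    case True
    then obtain j where j: "j < n" "K (j + 1) = 0" by blast
    have Kj: "\<bar>K j\<bar> = 1"
      using less.IH[OF j(1) less.prems(1,2) rec j(2)] .
    have Kj2: "K (j + 2) = K j" using rec[of j] j by simp
    \<comment> \<open>If \<open>n = j + 1\<close>, then \<open>K (n + 1) = K j\<close> would be
      nonzero.\<close>
    with Kj less.prems(4) j(1) have jn: "j + 2 \<le> n"
      by (cases "n = j + 1") auto
    \<comment> \<open>Dividing by \<open>K j\<close>, which is 1 or -1, restores the initial value 1
      and changes no absolute value.\<close>
    define K' where "K' i = K (j + 2 + i) / K j" for i
    define m' where "m' i = m (j + 2 + i)" for i
    have "\<bar>K' (n - j - 2)\<bar> = 1"
    proof (rule less.IH)
      show "n - j - 2 < n" using jn by simp
      show "K' 0 = 1" using Kj2 Kj by (auto simp: K'_def)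
      show "K' 1 = sqrt q * m' 0"
        using rec[of "j + 1"] j(2) Kj2 Kj by (auto simp: K'_def m'_def eval_nat_numeral)
      show "K' (i + 2) = sqrt q * m' (i + 1) * K' (i + 1) + K' i" for i
        using rec[of "j + 2 + i"] by (simp add: K'_def m'_def add_divide_distrib add_ac)
      have "j + 2 + (n - j - 2 + 1) = n + 1" using jn by simp
      then show "K' (n - j - 2 + 1) = 0"
        using less.prems(4) by (simp only: K'_def div_0)
    qed
    moreover have "j + 2 + (n - j - 2) = n" using jn by simp
    ultimately show ?thesis using Kj by (simp only: K'_def abs_divide div_by_1)
  next
    \<comment> \<open>With no earlier zero the list is a genuine loop, so its weight, which equals
      \<open>\<bar>K n\<bar>\<close>, must be 1.\<close>
    case False
    let ?ms = "map m [0..<Suc n]"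
    have c: "cfrac q (map m [0..<Suc j]) = K (j + 1) / (sqrt q * K j)" if "j \<le> n" for j
      using that False by (intro cfrac_eq_quotient[OF \<open>q > 0\<close> less.prems(1,2) rec]) auto
    have nz: "K j \<noteq> 0" if "j \<le> n" for j
      using that False less.prems(1) by (cases j) (auto simp: Suc_le_eq)
    have take: "take (Suc j) ?ms = map m [0..<Suc j]" if "j < n" for j
      using that by (simp add: take_map del: upt_Suc)
    have "?ms \<in> loops q"
      unfolding loops_def is_path_def mem_Collect_eq
    proof (intro conjI allI impI)
      fix j assume "j < length ?ms - 1"
      then have "j < n" by simp
      then show "cfrac q (take (Suc j) ?ms) \<noteq> 0"
        using take[of j] c[of j] nz[of j] nz[of "Suc j"] \<open>q > 0\<close> by simp
    qed (use c[of n] less.prems(4) in auto)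
    then have "weight q ?ms = 1"
      using assms(1,2) unfolding forbidden_def by blast
    also have "weight q ?ms = sqrt q ^ n * (\<Prod>j<n. \<bar>K (j + 1) / (sqrt q * K j)\<bar>)"
    proof -
      have "q powr (n / 2) = sqrt q ^ n"
        using \<open>q > 0\<close> by (simp add: powr_half_sqrt_powr powr_realpow real_sqrt_power)
      moreover have "(\<Prod>j<n. \<bar>cfrac q (take (Suc j) ?ms)\<bar>) = (\<Prod>j<n. \<bar>K (j + 1) / (sqrt q * K j)\<bar>)"
        by (intro prod.cong refl) (use take c in auto)
      ultimately show ?thesis
        unfolding weight_def by simp
    qed
    also have "\<dots> = \<bar>K n\<bar>"
      using less.prems(1) False \<open>q > 0\<close> by (intro prod_telescope_abs) auto
    finally show ?thesis by simp
  qed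
qed

section \<open>Loops in the trigonometric parametrisation\<close>

text \<open>By \<open>eq\<close> the recurrence reaches 0 after \<open>3 * A - 1\<close>
  coefficients, and the value \<open>V N\<close> before that satisfies
  \<open>V N * sin (2 * A * \<theta>) = sin (A * \<theta>)\<close>. If \<open>q\<close> were not
  forbidden, \<open>\<bar>V N\<bar> = 1\<close> would contradict \<open>ne\<close>.\<close>

lemma forbidden_if_trig:
  fixes \<theta> :: real and A :: nat
  assumes "cos \<theta> > 0" and "sin \<theta> > 0" and "A > 0"
    and eq: "sin (3 * A * \<theta>) * sin \<theta> + 2 * cos \<theta> * sin (A * \<theta>) * sin (2 * A * \<theta>) = 0"
    and ne: "\<bar>sin (A * \<theta>)\<bar> \<noteq> \<bar>sin (2 * A * \<theta>)\<bar>"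
  shows "forbidden (4 * (cos \<theta>)\<^sup>2)"
proof (rule ccontr)
  assume nf: "\<not> forbidden (4 * (cos \<theta>)\<^sup>2)"
  define q where "q = 4 * (cos \<theta>)\<^sup>2"
  have sq: "sqrt q = 2 * cos \<theta>"
    using assms(1) by (simp add: q_def real_sqrt_mult)
  have "q > 0" using assms(1) by (simp add: q_def)
  define S where "S n = sin (real n * \<theta>)" for n
  have Srec: "S (n + 2) = 2 * cos \<theta> * S (n + 1) - S n" for n
  proof -
    have "S (n + 2) = sin (real (n + 1) * \<theta> + \<theta>)" "S n = sin (real (n + 1) * \<theta> - \<theta>)"
      by (simp_all add: S_def algebra_simps)
    then show ?thesis by (simp add: sin_add sin_diff S_def)
  qed
  have S0: "S 0 = 0" and S1: "S 1 = sin \<theta>" by (simp_all add: S_def)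
  \<comment> \<open>Raising the coefficient at index \<open>A - 1\<close> from 1 to 2 adds
    \<open>2 * cos \<theta> * S A / sin \<theta>\<close> to \<open>V A\<close>. This perturbation
    propagates as a shifted copy of \<open>S\<close>, the second summand of
    \<open>V\<close>.\<close>
  define c :: "nat \<Rightarrow> int" where "c n = (if n + 1 = A then 2 else 1)" for n
  \<comment> \<open>The signs in \<open>m\<close> and \<open>K\<close> turn the recurrence of
    \<open>V\<close>, with \<open>- V n\<close>, into that of \<open>K\<close>, with
    \<open>+ K n\<close>.\<close>
  define m where "m n = (-1) ^ n * c n" for n
  \<comment> \<open>The truncated subtraction makes the second summand vanish for \<open>n < A\<close>.\<close>
  define V where "V n = (S (n + 1) + 2 * cos \<theta> * S A * S (n + 1 - A) / sin \<theta>) / sin \<theta>" for n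
  define K :: "nat \<Rightarrow> real" where "K n = (-1) ^ (n div 2) * V n" for n
  have V0: "V 0 = 1" using S1 S0 assms(2,3) by (simp add: V_def)
  have V1: "V 1 = 2 * cos \<theta> * c 0"
    using S1 S0 assms(2,3) Srec[of 0] by (auto simp: V_def c_def field_simps)
  have Vrec: "V (n + 2) = 2 * cos \<theta> * c (n + 1) * V (n + 1) - V n" for n
  proof -
    \<comment> \<open>\<open>c (n + 1)\<close> is 2 exactly when \<open>n + 2 = A\<close>; there the
      second summand starts with \<open>S 1\<close>, and afterwards both summands obey the
      recurrence of \<open>S\<close>.\<close>
    consider "n + 2 < A" | "n + 2 = A" | "n + 2 > A" by linarith
    then show ?thesis
    proof cases
      case 1
      then show ?thesis
        using Srec[of "n + 1"] assms(2) S0 by (simp add: V_def c_def field_simps)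
    next
      case 2
      then show ?thesis
        using Srec[of "n + 1"] assms(2) S0 S1 by (auto simp: V_def c_def field_simps)
    next
      case 3
      then have "A \<le> n + 1" by simp
      then obtain d where d: "n + 1 = A + d" using le_Suc_ex by blast
      have e: "n + 1 - A = d" "n + 2 - A = d + 1" "n + 3 - A = d + 2" using d by auto
      have V: "V n = (S (n + 1) + 2 * cos \<theta> * S A * S d / sin \<theta>) / sin \<theta>"
        "V (n + 1) = (S (n + 2) + 2 * cos \<theta> * S A * S (d + 1) / sin \<theta>) / sin \<theta>"
        "V (n + 2) = (S (n + 3) + 2 * cos \<theta> * S A * S (d + 2) / sin \<theta>) / sin \<theta>"
        using e by (simp_all add: V_def eval_nat_numeral)
      have S3: "S (n + 3) = 2 * cos \<theta> * S (n + 2) - S (n + 1)"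
        using Srec[of "n + 1"] by (simp add: eval_nat_numeral)
      have "V (n + 2) = 2 * cos \<theta> * V (n + 1) - V n"
        unfolding V S3 Srec[of d] using assms(2) by (simp add: field_simps)
      then show ?thesis using 3 by (simp add: c_def)
    qed
  qed
  obtain N where N: "3 * A = N + 2"
    using that[of "3 * A - 2"] \<open>A > 0\<close> by simp
  have "\<bar>K N\<bar> = 1"
  proof (rule abs_eq_1_if_not_forbidden[where m = m])
    show "q > 0" "\<not> forbidden q" using \<open>q > 0\<close> nf by (simp_all add: q_def)
    show "K 0 = 1" by (simp add: K_def V0)
    show "K 1 = sqrt q * m 0" using V1 by (simp add: K_def m_def sq)
    show "K (n + 2) = sqrt q * m (n + 1) * K (n + 1) + K n" for n
    proof -
      have sign: "(-1::real) ^ ((n + 1) div 2) = (-1) ^ n * (-1) ^ (n div 2)"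
      proof (cases "even n")
        case False
        then have "(n + 1) div 2 = Suc (n div 2)" by presburger
        then show ?thesis using False by simp
      qed simp
      have "K (n + 2) = - ((-1) ^ (n div 2)) * V (n + 2)"
        "K (n + 1) = (-1) ^ n * (-1) ^ (n div 2) * V (n + 1)"
        unfolding K_def sign by simp_all
      then show ?thesis
        unfolding Vrec by (cases "even n") (simp_all add: K_def m_def sq algebra_simps)
    qed
    have "N + 2 - A = 2 * A" using N by simp
    then have "V (N + 1) = (S (3 * A) + 2 * cos \<theta> * S A * S (2 * A) / sin \<theta>) / sin \<theta>"
      using N by (simp add: V_def)
    also have "\<dots> = (S (3 * A) * sin \<theta> + 2 * cos \<theta> * S A * S (2 * A)) / sin \<theta> / sin \<theta>"
      using assms(2) by (simp add: field_simps)
    also have "\<dots> = 0" using eq by (simp add: S_def)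
    finally show "K (N + 1) = 0" by (simp add: K_def)
  qed
  then have VN: "\<bar>V N\<bar> = 1" by (simp add: K_def abs_mult)
  define x y where "x = A * \<theta>" and "y = 2 * A * \<theta>"
  have xy: "3 * A * \<theta> = x + y" by (simp add: x_def y_def)
  have "real N + 1 = 3 * A - 1" using N by linarith
  then have S3: "S (N + 1) = sin (x + y - \<theta>)"
    by (simp add: S_def x_def y_def algebra_simps)
  have "real (N + 1 - A) = 2 * A - 1" using N \<open>A > 0\<close> by (simp add: of_nat_diff)
  then have S2: "S (N + 1 - A) = sin (y - \<theta>)"
    by (simp add: S_def y_def algebra_simps)
  \<comment> \<open>Substituting this into \<open>V N * sin y\<close> leaves only addition formulas.
    Keeping the factor \<open>sin y\<close> instead of dividing by it also covers
    \<open>sin y = 0\<close>.\<close>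
  have eq': "2 * cos \<theta> * sin x * sin y = - sin (x + y) * sin \<theta>"
    using eq unfolding xy by (simp add: x_def y_def)
  have V: "V N = (sin (x + y - \<theta>) + 2 * cos \<theta> * sin x * sin (y - \<theta>) / sin \<theta>) / sin \<theta>"
    unfolding V_def S2 S3 by (simp add: S_def x_def)
  have "V N * sin y * (sin \<theta> * sin \<theta>)
      = sin (x + y - \<theta>) * sin \<theta> * sin y + (2 * cos \<theta> * sin x * sin y) * sin (y - \<theta>)"
    using assms(2) unfolding V by (simp add: field_simps)
  also have "\<dots> = (sin (x + y - \<theta>) * sin y - sin (x + y) * sin (y - \<theta>)) * sin \<theta>"
    unfolding eq' by (simp add: algebra_simps)
  also have "sin (x + y - \<theta>) * sin y - sin (x + y) * sin (y - \<theta>) = sin x * sin \<theta> * ((sin y)\<^sup>2 + (cos y)\<^sup>2)"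
    unfolding sin_add sin_diff cos_add by algebra
  finally have "V N * sin y = sin x"
    using assms(2) by simp
  then have "\<bar>sin x\<bar> = \<bar>sin y\<bar>" using VN by (metis abs_mult mult_1)
  then show False using ne by (simp add: x_def y_def)
qed

section \<open>Solutions in a prescribed interval, and density\<close>

text \<open>A whole period from \<open>k * pi\<close> to \<open>(k + 1) * pi\<close> fits between
  \<open>A * \<alpha>\<close> and \<open>A * \<beta>\<close>, so the intermediate value theorem can
  be applied to \<open>A * \<theta>\<close> modulo \<open>pi\<close>.\<close>

lemma trig_solution_exists:
  fixes \<alpha> \<beta> :: real and A k :: nat
  assumes "A > 0" and "0 \<le> \<alpha>" and "\<beta> \<le> pi / 2" and "A * \<alpha> < k * pi" and "(k + 1) * pi < A * \<beta>"
  shows "\<exists>\<theta>. \<alpha> < \<theta> \<and> \<theta> < \<beta> \<and> forbidden (4 * (cos \<theta>)\<^sup>2)"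
proof -
  define \<theta> where "\<theta> x = (k * pi + x) / A" for x
  have A\<theta>: "real A * \<theta> x = k * pi + x" for x using \<open>A > 0\<close> by (simp add: \<theta>_def)
  have rng: "\<alpha> < \<theta> x" "\<theta> x < \<beta>" if "0 \<le> x" "x \<le> pi" for x
  proof -
    have "A * \<alpha> < A * \<theta> x" "A * \<theta> x < A * \<beta>"
      using assms that unfolding A\<theta> by (simp_all add: algebra_simps)
    then show "\<alpha> < \<theta> x" "\<theta> x < \<beta>" using \<open>A > 0\<close> by simp_all
  qed
  have pos: "sin (\<theta> x) > 0" "cos (\<theta> x) > 0" if "0 \<le> x" "x \<le> pi" for x
    using rng[OF that] assms by (auto intro!: sin_gt_zero cos_gt_zero)
  \<comment> \<open>This is the loop equation up to the sign \<open>(-1) ^ k\<close>. At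
    \<open>pi / 3\<close> only the second summand survives, at \<open>pi / 2\<close> only the first,
    with opposite signs.\<close>
  define f where "f x = sin (3 * x) * sin (\<theta> x) + 2 * cos (\<theta> x) * sin x * sin (2 * x)" for x
  have "3 * (pi / 2) = pi / 2 + pi" by simp
  then have "sin (3 * (pi / 2)) = -1" by (metis sin_periodic_pi sin_pi_half)
  then have "f (pi / 2) < 0" using pos[of "pi / 2"] by (simp add: f_def)
  moreover have "f (pi / 3) > 0"
    using pos[of "pi / 3"] sin_gt_zero[of "2 * (pi / 3)"] by (simp add: f_def sin_60)
  moreover have "continuous_on {pi / 3..pi / 2} f"
    unfolding f_def \<theta>_def using \<open>A > 0\<close> by (intro continuous_intros) auto
  ultimately obtain x where x: "pi / 3 \<le> x" "x \<le> pi / 2" "f x = 0"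
    using IVT2'[of f "pi / 2" 0 "pi / 3"] by auto
  have "x \<noteq> pi / 3" "x \<noteq> pi / 2"
    using x(3) \<open>f (pi / 2) < 0\<close> \<open>f (pi / 3) > 0\<close> by (metis less_irrefl)+
  then have x': "pi / 3 < x" "x < pi / 2" using x(1,2) by linarith+
  have sx: "sin x > 0" "sin (2 * x) > 0" using x' by (auto intro!: sin_gt_zero)
  \<comment> \<open>\<open>cos x < 1 / 2\<close> makes
    \<open>sin (2 * x) = 2 * sin x * cos x\<close> smaller than \<open>sin x\<close>.\<close>
  have "cos x < cos (pi / 3)" using x' by (intro cos_monotone_0_pi) auto
  then have "sin x \<noteq> sin (2 * x)" using sx by (simp add: sin_double cos_60)
  have shift: "sin (n * A * \<theta> x) = (-1) ^ (n * k) * sin (n * x)" for n :: nat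
  proof -
    have "n * A * \<theta> x = n * (A * \<theta> x)" by simp
    also have "\<dots> = n * x + (n * k) * pi"
      unfolding A\<theta> by (simp add: algebra_simps)
    finally show ?thesis
      using sin_npi[of "n * k"] cos_npi[of "n * k"] by (simp add: sin_add mult_ac)
  qed
  have s1: "sin (A * \<theta> x) = (-1) ^ k * sin x"
    and s2: "sin (2 * A * \<theta> x) = sin (2 * x)"
    and s3: "sin (3 * A * \<theta> x) = (-1) ^ k * sin (3 * x)"
    using shift[of 1] shift[of 2] shift[of 3] by (simp_all add: power_mult)
  have "forbidden (4 * (cos (\<theta> x))\<^sup>2)"
  proof (rule forbidden_if_trig)
    show "cos (\<theta> x) > 0" "sin (\<theta> x) > 0" using pos[of x] x x' by auto
    have "sin (3 * A * \<theta> x) * sin (\<theta> x) + 2 * cos (\<theta> x) * sin (A * \<theta> x) * sin (2 * A * \<theta> x)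
      = (-1) ^ k * f x"
      unfolding s1 s2 s3 f_def by (simp add: algebra_simps)
    then show "sin (3 * A * \<theta> x) * sin (\<theta> x) + 2 * cos (\<theta> x) * sin (A * \<theta> x) * sin (2 * A * \<theta> x) = 0"
      using x(3) by simp
    show "\<bar>sin (A * \<theta> x)\<bar> \<noteq> \<bar>sin (2 * A * \<theta> x)\<bar>"
      unfolding s1 s2 using sx \<open>sin x \<noteq> sin (2 * x)\<close> by (simp add: abs_mult)
  qed (fact \<open>A > 0\<close>)
  then show ?thesis using rng[of x] x' by (intro exI[of _ "\<theta> x"]) auto
qed

theorem theorem1:
  fixes a b :: real
  assumes "0 \<le> a" and "a < b" and "b \<le> 4"
  shows "\<exists>q \<in> {a<..<b}. forbidden q"
proof -
  \<comment> \<open>\<open>4 * (cos \<theta>)\<^sup>2\<close> decreases on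
    \<open>{0..pi / 2}\<close>, so the endpoints swap.\<close>
  define \<alpha> \<beta> where "\<alpha> = arccos (sqrt b / 2)" and "\<beta> = arccos (sqrt a / 2)"
  have sb: "sqrt b \<le> 2" using assms real_sqrt_le_mono[of b 4] by simp
  have sab: "0 \<le> sqrt a" "sqrt a < sqrt b" using assms by simp_all
  then have "- 2 \<le> sqrt a" "- 2 \<le> sqrt b" "sqrt a \<le> 2" using sb by linarith+
  note sab = sab this
  have "\<alpha> < \<beta>" unfolding \<alpha>_def \<beta>_def using sb sab by (intro arccos_less_arccos) auto
  have "0 \<le> \<alpha>" unfolding \<alpha>_def using sb sab by (intro arccos_lbound) auto
  have "\<beta> \<le> pi / 2" unfolding \<beta>_def using sb sab by (intro arccos_le_pi2) auto
  have c: "cos \<alpha> = sqrt b / 2" "cos \<beta> = sqrt a / 2"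
    unfolding \<alpha>_def \<beta>_def using sb sab by (auto intro!: cos_arccos)
  \<comment> \<open>An interval longer than \<open>2 * pi\<close> contains a full period between
    consecutive multiples of \<open>pi\<close>; \<open>k\<close> below is the first multiple past
    \<open>A * \<alpha>\<close>.\<close>
  obtain A :: nat where A: "2 * pi < A * (\<beta> - \<alpha>)"
    using reals_Archimedean3[of "\<beta> - \<alpha>"] \<open>\<alpha> < \<beta>\<close> by auto
  then have "A > 0" by (cases A) auto
  define k where "k = nat (\<lfloor>A * \<alpha> / pi\<rfloor> + 1)"
  have "A * \<alpha> / pi \<ge> 0" using \<open>0 \<le> \<alpha>\<close> by simp
  then have "real k = of_int \<lfloor>A * \<alpha> / pi\<rfloor> + 1" by (simp add: k_def)
  then have "A * \<alpha> / pi < k" "k \<le> A * \<alpha> / pi + 1" by linarith+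
  then have k: "A * \<alpha> < k * pi" "k * pi \<le> A * \<alpha> + pi" by (simp_all add: field_simps)
  then have "(k + 1) * pi < A * \<beta>" using A by (simp add: algebra_simps)
  then obtain \<theta> where \<theta>: "\<alpha> < \<theta>" "\<theta> < \<beta>" "forbidden (4 * (cos \<theta>)\<^sup>2)"
    using trig_solution_exists[OF \<open>A > 0\<close> \<open>0 \<le> \<alpha>\<close> \<open>\<beta> \<le> pi / 2\<close> k(1)] by auto
  have "cos \<beta> < cos \<theta>" "cos \<theta> < cos \<alpha>"
    using \<theta> \<open>0 \<le> \<alpha>\<close> \<open>\<beta> \<le> pi / 2\<close> by (auto intro!: cos_monotone_0_pi)
  then have "sqrt a < 2 * cos \<theta>" "2 * cos \<theta> < sqrt b" using c by simp_all
  then have "(sqrt a)\<^sup>2 < (2 * cos \<theta>)\<^sup>2" "(2 * cos \<theta>)\<^sup>2 < (sqrt b)\<^sup>2"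
    using sab by (intro power_strict_mono; linarith | simp)+
  moreover have "(sqrt a)\<^sup>2 = a" "(sqrt b)\<^sup>2 = b" "(2 * cos \<theta>)\<^sup>2 = 4 * (cos \<theta>)\<^sup>2"
    using assms by (simp_all add: power_mult_distrib)
  ultimately have "4 * (cos \<theta>)\<^sup>2 \<in> {a<..<b}" by (simp only: greaterThanLessThan_iff)
  then show ?thesis using \<theta>(3) by blast
qed

end
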